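(* Let $\theta>-1$, $\beta>-1$ and $0<\gamma<1$. The functions $\mathscr{L}_m^{(\theta,\beta,\gamma)}(x)=L_m^{(\theta)}\big((\beta+1)x^\gamma\big)$, $x>0$, $m\ge 0$, satisfy the following properties. (i) (Three-term recurrence) For $x>0$, $\mathscr{L}_0^{(\theta,\beta,\gamma)}(x)=1$, $\mathscr{L}_1^{(\theta,\beta,\gamma)}(x)=-(\beta+1)x^\gamma+\theta+1$, and for $m\ge1$ $$\mathscr{L}_{m+1}^{(\theta,\beta,\gamma)}(x)=\frac{2m+\theta+1-(\beta+1)x^\gamma}{m+1}\,\mathscr{L}_m^{(\theta,\beta,\gamma)}(x)-\frac{m+\theta}{m+1}\,\mathscr{L}_{m-1}^{(\theta,\beta,\gamma)}(x).$$ (ii) (Mapped derivative) With $\mathscr{D}_{\beta,\gamma}u(x):=\frac{x^{1-\gamma}}{(\beta+1)\gamma}\,\partial_xu(x)$, for every $m\ge1$ and $x>0$ $$-\mathscr{D}_{\beta,\gamma}\mathscr{L}_m^{(\theta,\beta,\gamma)}(x)=\mathscr{L}_{m-1}^{(\theta+1,\beta,\gamma)}(x)=\sum_{r=0}^{m-1}\mathscr{L}_r^{(\theta,\beta,\gamma)}(x).$$ (iii) (Orthogonality) With $\varrho^{\theta,\beta,\gamma}(x):=(\beta+1)^{\theta+1}\gamma\,x^{\gamma(\theta+1)-1}e^{-(\beta+1)x^\gamma}$, for all $m,\ell\ge0$ $$\int_0^\infty \mathscr{L}_m^{(\theta,\beta,\gamma)}(x)\,\mathscr{L}_\ell^{(\theta,\beta,\gamma)}(x)\,\varrho^{\theta,\beta,\gamma}(x)\,dx=h_m^{(\theta)}\delta_{m\ell},\qquad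 h_m^{(\theta)}=\frac{\Gamma(m+\theta+1)}{\Gamma(m+1)}.$$ (iv) (Sturm--Liouville form) For every $m\ge0$ and $x>0$ $$[\varrho^{\theta,\beta,\gamma}(x)]^{-1}\,\partial_x\Big((\beta+1)^\theta x^{\gamma\theta+1}e^{-(\beta+1)x^\gamma}\,\partial_x\mathscr{L}_m^{(\theta,\beta,\gamma)}(x)\Big)+m\gamma\,\mathscr{L}_m^{(\theta,\beta,\gamma)}(x)=0.$$ (v) (Scaled fractional Laguerre--Gauss quadrature) Let $M\ge0$ be an integer, let $\{y_i^{(\theta)},\varpi_i^{(\theta)}\}_{i=0}^M$ be the Laguerre--Gauss nodes and weights associated with $L_{M+1}^{(\theta)}$, and set $x_i^{(\theta,\beta,\gamma)}:=\big(y_i^{(\theta)}/(\beta+1)\big)^{1/\gamma}$ for $0\le i\le M$. Then $$\int_0^\infty q(x)\,\varrho^{\theta,\beta,\gamma}(x)\,dx=\sum_{i=0}^M q\big(x_i^{(\theta,\beta,\gamma)}\big)\,\varpi_i^{(\theta)}$$ for every $q\in\mathbb{P}_{2M+1}^\gamma:=\operatorname{span}\{1,x^\gamma,x^{2\gamma},\dots,x^{(2M+1)\gamma}\}$.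
   Context: For $\theta>-1$ and an integer $m\ge0$, $L_m^{(\theta)}(y)=\sum_{r=0}^m\frac{(-1)^r}{r!}\binom{m+\theta}{m-r}y^r$ is the generalized Laguerre polynomial of degree $m$, orthogonal on $(0,\infty)$ with respect to $y^\theta e^{-y}$: $\int_0^\infty L_m^{(\theta)}L_\ell^{(\theta)}y^\theta e^{-y}\,dy=h_m^{(\theta)}\delta_{m\ell}$ with $h_m^{(\theta)}=\Gamma(m+\theta+1)/\Gamma(m+1)$. The Laguerre--Gauss nodes $y_0^{(\theta)},\dots,y_M^{(\theta)}$ associated with $L_{M+1}^{(\theta)}$ are its $M+1$ zeros (all in $(0,\infty)$), and the weights are $$\varpi_i^{(\theta)}=\frac{\Gamma(M+\theta+1)}{(M+\theta+1)(M+1)!}\,\frac{y_i^{(\theta)}}{[L_M^{(\theta)}(y_i^{(\theta)})]^2};$$ the rule $\int_0^\infty q(y)y^\theta e^{-y}\,dy=\sum_{i=0}^M q(y_i^{(\theta)})\varpi_i^{(\theta)}$ is exact for all polynomials $q$ of degree at most $2M+1$. *)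

theory Defs
  imports "HOL-Analysis.Analysis"
begin

definition laguerre :: "nat \<Rightarrow> real \<Rightarrow> real \<Rightarrow> real" where
  "laguerre m \<theta> y =
     (\<Sum>r\<le>m. (-1) ^ r / fact r * ((real m + \<theta>) gchoose (m - r)) * y ^ r)"

definition laguerre_norm :: "nat \<Rightarrow> real \<Rightarrow> real" where
  "laguerre_norm m \<theta> = Gamma (real m + \<theta> + 1) / Gamma (real m + 1)"

text \<open>
  The labelling of the nodes is immaterial; here they are listed in increasing order,
  indexed from 0. The index \<open>M\<close> refers to the \<open>M + 1\<close> zeros of
  \<open>laguerre (M + 1) \<theta>\<close>. The value is meaningful for \<open>\<theta> > -1\<close> and \<open>i \<le> M\<close>, because all
  \<open>M + 1\<close> zeros of that polynomial are then real and simple.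
\<close>
definition laguerre_node :: "real \<Rightarrow> nat \<Rightarrow> nat \<Rightarrow> real" where
  "laguerre_node \<theta> M i = sorted_list_of_set {y. laguerre (M + 1) \<theta> y = 0} ! i"

definition laguerre_weight :: "real \<Rightarrow> nat \<Rightarrow> nat \<Rightarrow> real" where
  "laguerre_weight \<theta> M i =
     Gamma (real M + \<theta> + 1) / ((real M + \<theta> + 1) * fact (M + 1)) *
     (laguerre_node \<theta> M i / (laguerre M \<theta> (laguerre_node \<theta> M i))\<^sup>2)"

text \<open>
  The scaled fractional Laguerre functions (prefix \<open>sfl\<close>) below live on \<open>x > 0\<close>; their values elsewhere are irrelevant.
\<close>
definition sfl :: "nat \<Rightarrow> real \<Rightarrow> real \<Rightarrow> real \<Rightarrow> real \<Rightarrow> real" where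
  "sfl m \<theta> \<beta> \<gamma> x = laguerre m \<theta> ((\<beta> + 1) * x powr \<gamma>)"

definition mapped_deriv :: "real \<Rightarrow> real \<Rightarrow> (real \<Rightarrow> real) \<Rightarrow> real \<Rightarrow> real" where
  "mapped_deriv \<beta> \<gamma> u x = x powr (1 - \<gamma>) / ((\<beta> + 1) * \<gamma>) * deriv u x"

definition sfl_weight :: "real \<Rightarrow> real \<Rightarrow> real \<Rightarrow> real \<Rightarrow> real" where
  "sfl_weight \<theta> \<beta> \<gamma> x =
     (\<beta> + 1) powr (\<theta> + 1) * \<gamma> * x powr (\<gamma> * (\<theta> + 1) - 1) * exp (- (\<beta> + 1) * x powr \<gamma>)"

definition sfl_flux :: "nat \<Rightarrow> real \<Rightarrow> real \<Rightarrow> real \<Rightarrow> real \<Rightarrow> real" where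
  "sfl_flux m \<theta> \<beta> \<gamma> x =
     (\<beta> + 1) powr \<theta> * x powr (\<gamma> * \<theta> + 1) * exp (- (\<beta> + 1) * x powr \<gamma>) *
     deriv (sfl m \<theta> \<beta> \<gamma>) x"

text \<open>
  The span of \<open>1, x^\<gamma>, ..., x^(N \<gamma>)\<close> as functions on the open half-line: membership only
  constrains \<open>q\<close> on \<open>x > 0\<close>. There \<open>x powr 0 = 1\<close>, so \<open>k = 0\<close> gives the constants.
\<close>
definition frac_poly_space :: "real \<Rightarrow> nat \<Rightarrow> (real \<Rightarrow> real) set" where
  "frac_poly_space \<gamma> N =
     {q. \<exists>c :: nat \<Rightarrow> real. \<forall>x>0. q x = (\<Sum>k\<le>N. c k * x powr (real k * \<gamma>))}"

definition sfl_node :: "real \<Rightarrow> real \<Rightarrow> real \<Rightarrow> nat \<Rightarrow> nat \<Rightarrow> real" where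
  "sfl_node \<theta> \<beta> \<gamma> M i = (laguerre_node \<theta> M i / (\<beta> + 1)) powr (1 / \<gamma>)"

end

theory Submission
  imports Defs "HOL-Real_Asymp.Real_Asymp"
begin

text \<open>
  The substitution \<open>y = (\<beta> + 1) x\<^bsup>\<gamma>\<^esup>\<close> turns \<open>sfl_weight\<close> into \<open>y\<^bsup>\<theta>\<^esup> e\<^bsup>-y\<^esup>\<close>, so every claim reduces to
  one about Laguerre polynomials. There everything rests on the pair
  \<open>L\<^sub>m\<^sub>+\<^sub>1\<^bsup>(\<theta>)\<^esup>' = - L\<^sub>m\<^bsup>(\<theta>+1)\<^esup>\<close> and \<open>(y\<^bsup>\<theta>+1\<^esup> e\<^bsup>-y\<^esup> L\<^sub>m\<^bsup>(\<theta>+1)\<^esup>)' = (m + 1) y\<^bsup>\<theta>\<^esup> e\<^bsup>-y\<^esup> L\<^sub>m\<^sub>+\<^sub>1\<^bsup>(\<theta>)\<^esup>\<close>: integrating by parts, it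
  yields orthogonality and the norms by induction on the degree with \<open>\<theta>\<close> varying; applying
  Rolle's theorem (with the zeros at \<open>0\<close> and at infinity), it yields \<open>m\<close> positive zeros of
  \<open>L\<^sub>m\<^bsup>(\<theta>)\<^esup>\<close>. By the Christoffel-Darboux identity the reproducing kernel at the nodes satisfies
  \<open>\<varpi>\<^sub>i K(y\<^sub>j, y\<^sub>i) = \<delta>\<^sub>i\<^sub>j\<close>, so it provides the Lagrange basis whose integrals are the Gauss weights.
\<close>

section \<open>Laguerre polynomials\<close>

text \<open>An element of the polynomial type rather than a function: identities can then be checked
  coefficientwise, and degree, formal derivative, root count and division with remainder are
  available.\<close>

definition laguerre_poly :: "nat \<Rightarrow> real \<Rightarrow> real poly" where
  "laguerre_poly m \<theta> =
     (\<Sum>r\<le>m. monom ((-1) ^ r / fact r * ((real m + \<theta>) gchoose (m - r))) r)"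

lemma poly_laguerre_poly: "poly (laguerre_poly m \<theta>) y = laguerre m \<theta> y"
  by (simp add: laguerre_poly_def laguerre_def poly_sum poly_monom)

lemma coeff_laguerre_poly:
  "coeff (laguerre_poly m \<theta>) r =
     (if r \<le> m then (-1) ^ r / fact r * ((real m + \<theta>) gchoose (m - r)) else 0)"
  by (simp add: laguerre_poly_def coeff_sum if_distrib cong: if_cong)

lemma laguerre_poly_0 [simp]: "laguerre_poly 0 \<theta> = 1"
  by (simp add: laguerre_poly_def monom_0 one_pCons)

lemma degree_laguerre_poly [simp]: "degree (laguerre_poly m \<theta>) = m"
proof (rule antisym)
  show "degree (laguerre_poly m \<theta>) \<le> m"
    by (rule degree_le) (simp add: coeff_laguerre_poly)
  show "m \<le> degree (laguerre_poly m \<theta>)"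
    by (rule le_degree) (simp add: coeff_laguerre_poly)
qed

lemma laguerre_poly_nonzero [simp]: "laguerre_poly m \<theta> \<noteq> 0"
proof
  assume "laguerre_poly m \<theta> = 0"
  then have "coeff (laguerre_poly m \<theta>) m = 0" by simp
  then show False by (simp add: coeff_laguerre_poly)
qed

text \<open>Pascal's rule in each coefficient of order at most \<open>m\<close>; in order
  \<open>m + 1\<close> both leading coefficients carry a binomial with lower index 0.\<close>

lemma laguerre_poly_Suc_shift:
  "laguerre_poly (Suc m) \<theta> = laguerre_poly (Suc m) (\<theta> + 1) - laguerre_poly m (\<theta> + 1)"
proof (rule poly_eqI)
  fix r
  consider "r \<le> m" | "r = Suc m" | "r > Suc m" by linarith
  then show "coeff (laguerre_poly (Suc m) \<theta>) r =
      coeff (laguerre_poly (Suc m) (\<theta> + 1) - laguerre_poly m (\<theta> + 1)) r"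
  proof cases
    case 1
    then have "Suc m - r = Suc (m - r)" by simp
    moreover have "(real (Suc m) + (\<theta> + 1)) gchoose (Suc (m - r)) =
        ((real (Suc m) + \<theta>) gchoose (m - r)) + ((real (Suc m) + \<theta>) gchoose (Suc (m - r)))"
      using gbinomial_Suc_Suc[of "real (Suc m) + \<theta>" "m - r"] by (simp add: algebra_simps)
    moreover have "real m + (\<theta> + 1) = real (Suc m) + \<theta>" by simp
    ultimately show ?thesis using 1 by (simp add: coeff_laguerre_poly algebra_simps)
  qed (simp_all add: coeff_laguerre_poly)
qed

text \<open>The factor \<open>r + 1\<close> from differentiation cancels in the factorial. Lowering
  the degree and raising the parameter together leave the upper binomial argument unchanged.\<close>

lemma pderiv_laguerre_poly_Suc:
  "pderiv (laguerre_poly (Suc m) \<theta>) = - laguerre_poly m (\<theta> + 1)"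
proof (rule poly_eqI)
  fix r
  have "(real (Suc m) + \<theta>) gchoose k = (real m + (\<theta> + 1)) gchoose k" for k
    by (simp add: algebra_simps)
  then show "coeff (pderiv (laguerre_poly (Suc m) \<theta>)) r = coeff (- laguerre_poly m (\<theta> + 1)) r"
    by (simp add: coeff_pderiv coeff_laguerre_poly del: of_nat_Suc)
qed

text \<open>Absorption rewrites both binomials on the right as multiples of \<open>?G\<close>, with
  factors \<open>m - r + 1\<close> and \<open>m + 1\<close>. The difference \<open>- r\<close> then
  turns \<open>1 / fact r\<close> into the coefficient of order \<open>r - 1\<close> on the
  left.\<close>

lemma laguerre_poly_mult_X:
  "pCons 0 (laguerre_poly m (\<theta> + 1)) =
     smult (real m + \<theta> + 1) (laguerre_poly m \<theta>) - smult (real m + 1) (laguerre_poly (Suc m) \<theta>)"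
proof (rule poly_eqI)
  fix r
  show "coeff (pCons 0 (laguerre_poly m (\<theta> + 1))) r =
      coeff (smult (real m + \<theta> + 1) (laguerre_poly m \<theta>)
        - smult (real m + 1) (laguerre_poly (Suc m) \<theta>)) r"
  proof (cases "r \<le> m")
    case True
    let ?G = "(real m + \<theta> + 1) gchoose (Suc (m - r))"
    have abs: "(real m + \<theta> + 1) * ((real m + \<theta>) gchoose (m - r)) = real (Suc (m - r)) * ?G"
      using gbinomial_absorption[of "m - r" "real m + \<theta> + 1"] by simp
    have R: "coeff (smult (real m + \<theta> + 1) (laguerre_poly m \<theta>)
        - smult (real m + 1) (laguerre_poly (Suc m) \<theta>)) r =
        (-1) ^ r / fact r * ((real m + \<theta> + 1) * ((real m + \<theta>) gchoose (m - r)) - (real m + 1) * ?G)"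
      using True by (simp add: coeff_laguerre_poly Suc_diff_le algebra_simps add_divide_distrib)
    also have "\<dots> = (-1) ^ r / fact r * (real (Suc (m - r)) * ?G - (real m + 1) * ?G)"
      unfolding abs ..
    also have "\<dots> = (-1) ^ r / fact r * (- real r * ?G)"
      using True by (simp add: of_nat_diff algebra_simps)
    also have "\<dots> = coeff (pCons 0 (laguerre_poly m (\<theta> + 1))) r"
    proof (cases r)
      case (Suc k)
      then have "m - k = Suc (m - r)" using True by simp
      then show ?thesis using Suc True
        by (simp add: coeff_laguerre_poly field_simps del: of_nat_Suc)
    qed simp
    finally show ?thesis ..
  next
    case False
    then show ?thesis
      by (cases "r = Suc m")
        (auto simp: coeff_laguerre_poly coeff_pCons divide_simps simp del: of_nat_Suc split: nat.splits)
  qed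
qed

text \<open>This is \<open>(y\<^bsup>\<theta>+1\<^esup> e\<^bsup>-y\<^esup> L\<^sub>m\<^bsup>(\<theta>+1)\<^esup>)' = (m + 1) y\<^bsup>\<theta>\<^esup> e\<^bsup>-y\<^esup> L\<^sub>m\<^sub>+\<^sub>1\<^bsup>(\<theta>)\<^esup>\<close> with the weight cancelled.\<close>
lemma laguerre_poly_raising:
  "pCons 0 (pderiv (laguerre_poly m (\<theta> + 1))) + [:\<theta> + 1, -1:] * laguerre_poly m (\<theta> + 1) =
     smult (real m + 1) (laguerre_poly (Suc m) \<theta>)"
proof -
  \<comment> \<open>For \<open>m = n + 1\<close> the derivative is lowered to parameter
    \<open>\<theta> + 2\<close>. Multiplication by \<open>y\<close> brings it back to
    \<open>\<theta> + 1\<close>, and the shift identity removes what remains of degree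
    \<open>n\<close>.\<close>
  have "y * poly (pderiv (laguerre_poly m (\<theta> + 1))) y + (\<theta> + 1 - y) * poly (laguerre_poly m (\<theta> + 1)) y =
      (real m + 1) * poly (laguerre_poly (Suc m) \<theta>) y" for y
  proof (cases m)
    case 0
    then show ?thesis
      using arg_cong[OF laguerre_poly_mult_X[of 0 \<theta>], of "\<lambda>p. poly p y"] by simp
  next
    case (Suc n)
    have "y * poly (laguerre_poly n (\<theta> + 1 + 1)) y =
        (real n + (\<theta> + 1) + 1) * poly (laguerre_poly n (\<theta> + 1)) y
        - (real n + 1) * poly (laguerre_poly m (\<theta> + 1)) y"
      using arg_cong[OF laguerre_poly_mult_X[of n "\<theta> + 1"], of "\<lambda>p. poly p y"] Suc by simp
    moreover have "y * poly (laguerre_poly m (\<theta> + 1)) y =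
        (real m + \<theta> + 1) * poly (laguerre_poly m \<theta>) y
        - (real m + 1) * poly (laguerre_poly (Suc m) \<theta>) y"
      using arg_cong[OF laguerre_poly_mult_X[of m \<theta>], of "\<lambda>p. poly p y"] by simp
    moreover have "poly (laguerre_poly m \<theta>) y =
        poly (laguerre_poly m (\<theta> + 1)) y - poly (laguerre_poly n (\<theta> + 1)) y"
      using laguerre_poly_Suc_shift[of n \<theta>] Suc by simp
    moreover have "poly (pderiv (laguerre_poly m (\<theta> + 1))) y = - poly (laguerre_poly n (\<theta> + 1 + 1)) y"
      using pderiv_laguerre_poly_Suc[of n "\<theta> + 1"] Suc by simp
    moreover have "real m = real n + 1" using Suc by simp
    ultimately show ?thesis by algebra
  qed
  then show ?thesis
    by (intro poly_ext) (simp add: algebra_simps)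
qed

text \<open>Multiply the shift identity by \<open>y\<close> and apply
  \<open>laguerre_poly_mult_X\<close> to both terms, which eliminates the parameter
  \<open>\<theta> + 1\<close>. The index starts one higher than usual to avoid
  \<open>m - 1\<close>.\<close>

lemma laguerre_poly_recurrence:
  "(real m + 2) * poly (laguerre_poly (Suc (Suc m)) \<theta>) y =
     (2 * real m + \<theta> + 3 - y) * poly (laguerre_poly (Suc m) \<theta>) y
     - (real m + 1 + \<theta>) * poly (laguerre_poly m \<theta>) y"
proof -
  have shift: "y * poly (laguerre_poly (Suc m) \<theta>) y =
      y * poly (laguerre_poly (Suc m) (\<theta> + 1)) y - y * poly (laguerre_poly m (\<theta> + 1)) y"
    by (simp add: laguerre_poly_Suc_shift[of m \<theta>] algebra_simps)
  have X: "y * poly (laguerre_poly k (\<theta> + 1)) y =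
      (real k + \<theta> + 1) * poly (laguerre_poly k \<theta>) y
      - (real k + 1) * poly (laguerre_poly (Suc k) \<theta>) y" for k
    using arg_cong[OF laguerre_poly_mult_X[of k \<theta>], of "\<lambda>p. poly p y"] by simp
  show ?thesis using shift X[of m] X[of "Suc m"] by (simp add: algebra_simps)
qed

text \<open>The shift identity telescopes.\<close>

lemma laguerre_poly_sum:
  "poly (laguerre_poly m (\<theta> + 1)) y = (\<Sum>r=0..m. poly (laguerre_poly r \<theta>) y)"
proof (induction m)
  case (Suc m)
  then show ?case by (simp add: laguerre_poly_Suc_shift[of m \<theta>])
qed simp

text \<open>At a zero of the polynomial this expresses its derivative through the preceding
  polynomial, which is how \<open>laguerre_poly M\<close> enters the Gauss weights.\<close>

lemma poly_pderiv_laguerre_poly_Suc: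
  "y * poly (pderiv (laguerre_poly (Suc m) \<theta>)) y =
     (real m + 1) * poly (laguerre_poly (Suc m) \<theta>) y
     - (real m + 1 + \<theta>) * poly (laguerre_poly m \<theta>) y"
  using arg_cong[OF laguerre_poly_mult_X[of m \<theta>], of "\<lambda>p. poly p y"]
  by (simp add: pderiv_laguerre_poly_Suc algebra_simps)

section \<open>Integration against the Laguerre weight\<close>

text \<open>Reduces additive statements about integrals to the moments of the weight.\<close>

lemma poly_monom_induct [case_names monom add]:
  assumes "\<And>c k. P (monom c k)" and "\<And>p q. P p \<Longrightarrow> P q \<Longrightarrow> P (p + q)"
  shows "P p"
proof -
  have "P (\<Sum>i\<le>n. monom (coeff p i) i)" for n
    by (induction n) (use assms in auto)
  then show ?thesis
    by (metis poly_as_sum_of_monoms)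
qed

text \<open>Absolute integrability refers to the completed measure; Borel measurability of the
  integrand permits the return to \<open>lborel\<close>.\<close>

lemma set_integrable_lborel_of_absolutely_integrable:
  fixes f :: "real \<Rightarrow> real"
  assumes f: "f absolutely_integrable_on S"
    and S [measurable]: "S \<in> sets borel" and meas [measurable]: "f \<in> borel_measurable borel"
  shows "set_integrable lborel S f" "(LBINT x:S. f x) = integral S f"
proof -
  show int: "set_integrable lborel S f"
    using f unfolding set_integrable_def by (subst (asm) integrable_completion) simp_all
  show "(LBINT x:S. f x) = integral S f"
    by (rule set_borel_integral_eq_integral(2)[OF int])
qed

lemma laguerre_weight_integral:
  fixes \<theta> :: real
  assumes "\<theta> > -1"
  shows "set_integrable lborel {0<..} (\<lambda>y. y powr \<theta> * exp (-y))"
    and "(LBINT y:{0<..}. y powr \<theta> * exp (-y)) = Gamma (\<theta> + 1)"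
proof -
  have *: "((\<lambda>t. t powr \<theta> * exp (-t)) has_integral Gamma (\<theta> + 1)) {0..}" (is "(?w has_integral _) _")
    using Gamma_integral_real[of "\<theta> + 1"] assms by (simp add: exp_minus field_simps)
  \<comment> \<open>The Gamma integral includes the endpoint 0, a null set.\<close>
  have "negligible {t \<in> {0..} - {0<..}. t powr \<theta> * exp (-t) \<noteq> 0}"
    by (rule negligible_subset[OF negligible_sing[of "0::real"]]) auto
  moreover have "negligible {t \<in> {0<..} - {0..}. t powr \<theta> * exp (-t) \<noteq> 0}"
    by (rule negligible_subset[OF negligible_sing[of "0::real"]]) auto
  ultimately have hi: "(?w has_integral Gamma (\<theta> + 1)) {0<..}"
    using has_integral_spike_set_eq[of "{0..}" "{0<..}" ?w "Gamma (\<theta> + 1)"] * by blast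
  then have ai: "(\<lambda>t. t powr \<theta> * exp (-t)) absolutely_integrable_on {0<..}"
    by (intro nonnegative_absolutely_integrable_1) auto
  show "set_integrable lborel {0<..} (\<lambda>y. y powr \<theta> * exp (-y))"
    by (rule set_integrable_lborel_of_absolutely_integrable[OF ai]) simp_all
  show "(LBINT y:{0<..}. y powr \<theta> * exp (-y)) = Gamma (\<theta> + 1)"
    using set_integrable_lborel_of_absolutely_integrable(2)[OF ai] hi by (simp add: integral_unique)
qed

text \<open>The moment functional of the Laguerre weight: orthogonality and quadrature become
  algebra of a linear functional on polynomials.\<close>

definition laguerre_functional :: "real \<Rightarrow> real poly \<Rightarrow> real" where
  "laguerre_functional \<theta> p = (LBINT y:{0<..}. poly p y * (y powr \<theta> * exp (-y)))"

lemma poly_monom_mult_powr: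
  fixes \<theta> :: real
  assumes "y > 0"
  shows "poly (monom c k) y * (y powr \<theta> * exp (-y)) = c * (y powr (\<theta> + real k) * exp (-y))"
  using assms by (simp add: poly_monom powr_add powr_realpow)

lemma set_integrable_poly_laguerre_weight:
  fixes \<theta> :: real
  assumes "\<theta> > -1"
  shows "set_integrable lborel {0<..} (\<lambda>y. poly p y * (y powr \<theta> * exp (-y)))"
proof (induction p rule: poly_monom_induct)
  case (monom c k)
  have "set_integrable lborel {0<..} (\<lambda>y. c * (y powr (\<theta> + real k) * exp (-y)))"
    using assms by (intro set_integrable_mult_right laguerre_weight_integral) auto
  also have "?this \<longleftrightarrow> ?case"
    by (intro set_integrable_cong refl) (simp add: poly_monom_mult_powr)
  finally show ?case .
next
  case (add p q)
  then show ?case by (simp add: distrib_right)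
qed

lemma laguerre_functional_monom:
  assumes "\<theta> > -1"
  shows "laguerre_functional \<theta> (monom c k) = c * Gamma (\<theta> + real k + 1)"
proof -
  have "laguerre_functional \<theta> (monom c k) =
      (LBINT y:{0<..}. c * (y powr (\<theta> + real k) * exp (-y)))"
    unfolding laguerre_functional_def
    by (intro set_lebesgue_integral_cong) (auto simp: poly_monom_mult_powr)
  then show ?thesis
    using laguerre_weight_integral(2)[of "\<theta> + real k"] assms by simp
qed

lemma laguerre_functional_add:
  assumes "\<theta> > -1"
  shows "laguerre_functional \<theta> (p + q) = laguerre_functional \<theta> p + laguerre_functional \<theta> q"
  using assms by (simp add: laguerre_functional_def distrib_right set_integrable_poly_laguerre_weight)

lemma laguerre_functional_smult:
  "laguerre_functional \<theta> (smult c p) = c * laguerre_functional \<theta> p"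
  by (simp add: laguerre_functional_def mult.assoc)

lemma laguerre_functional_0 [simp]: "laguerre_functional \<theta> 0 = 0"
  by (simp add: laguerre_functional_def)

lemma laguerre_functional_sum:
  assumes "\<theta> > -1"
  shows "laguerre_functional \<theta> (\<Sum>i\<in>A. f i) = (\<Sum>i\<in>A. laguerre_functional \<theta> (f i))"
  by (induction A rule: infinite_finite_induct) (simp_all add: laguerre_functional_add assms)

lemma laguerre_functional_pCons_0:
  "laguerre_functional \<theta> (pCons 0 p) = laguerre_functional (\<theta> + 1) p"
  unfolding laguerre_functional_def
  by (intro set_lebesgue_integral_cong) (auto simp: powr_add)

text \<open>Integration by parts, \<open>\<integral> (y\<^bsup>\<theta>+1\<^esup> e\<^bsup>-y\<^esup> p)' = 0\<close>.\<close>
lemma laguerre_functional_by_parts: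
  assumes "\<theta> > -1"
  shows "laguerre_functional \<theta> (pCons 0 (pderiv p) + [:\<theta> + 1, -1:] * p) = 0"
proof (induction p rule: poly_monom_induct)
  case (monom c k)
  have G: "Gamma (\<theta> + real k + 2) = (\<theta> + real k + 1) * Gamma (\<theta> + real k + 1)"
    using Gamma_plus1[of "\<theta> + real k + 1"] assms by (simp add: pochhammer_eq_0_iff nonpos_Ints_def add_ac)
  \<comment> \<open>On a monomial the expression is
    \<open>c * ((\<theta> + k + 1) * y ^ k - y ^ (k + 1))\<close>, so the claim is exactly the
    functional equation of Gamma.\<close>
  have "pCons 0 (pderiv (monom c k)) + [:\<theta> + 1, -1:] * monom c k =
      monom ((\<theta> + real k + 1) * c) k + monom (-c) (Suc k)"
    by (rule poly_ext) (cases k; simp add: pderiv_monom poly_monom algebra_simps)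
  then show ?case
    using assms G by (simp add: laguerre_functional_add laguerre_functional_monom add_ac)
next
  case (add p q)
  have "pCons 0 (pderiv (p + q)) + [:\<theta> + 1, -1:] * (p + q) =
      (pCons 0 (pderiv p) + [:\<theta> + 1, -1:] * p) + (pCons 0 (pderiv q) + [:\<theta> + 1, -1:] * q)"
    by (rule poly_ext) (simp add: pderiv_add algebra_simps)
  then show ?case
    using add assms by (simp only: laguerre_functional_add)
qed

text \<open>Apply integration by parts to the product of
  \<open>laguerre_poly m (\<theta> + 1)\<close> and \<open>q\<close>; the raising identity collects
  the terms without \<open>pderiv q\<close>. Each use trades one degree for one unit of the
  parameter and differentiates \<open>q\<close>, which drives the two inductions below.\<close>

lemma laguerre_functional_Suc_mult:
  assumes "\<theta> > -1"
  shows "(real m + 1) * laguerre_functional \<theta> (laguerre_poly (Suc m) \<theta> * q) =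
    - laguerre_functional (\<theta> + 1) (laguerre_poly m (\<theta> + 1) * pderiv q)"
proof -
  let ?p = "laguerre_poly m (\<theta> + 1)"
  have "pCons 0 (pderiv (?p * q)) + [:\<theta> + 1, -1:] * (?p * q) =
      (pCons 0 (pderiv ?p) + [:\<theta> + 1, -1:] * ?p) * q + pCons 0 (?p * pderiv q)"
    by (rule poly_ext) (simp add: pderiv_mult algebra_simps)
  also have "\<dots> = smult (real m + 1) (laguerre_poly (Suc m) \<theta> * q) + pCons 0 (?p * pderiv q)"
    by (simp only: laguerre_poly_raising mult_smult_left)
  finally have "0 = laguerre_functional \<theta>
      (smult (real m + 1) (laguerre_poly (Suc m) \<theta> * q) + pCons 0 (?p * pderiv q))"
    using laguerre_functional_by_parts[OF assms, of "?p * q"] by simp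
  then show ?thesis
    using assms
    by (simp add: laguerre_functional_add laguerre_functional_smult laguerre_functional_pCons_0)
qed

text \<open>Repeated transfer of derivatives kills \<open>q\<close> before the Laguerre degree is
  exhausted. The disjunct \<open>q = 0\<close> is needed because the derivative of a constant is 0,
  whose degree is 0 and not negative; it is also the whole base case.\<close>

lemma laguerre_functional_lower_degree:
  assumes "\<theta> > -1" "q = 0 \<or> degree q < m"
  shows "laguerre_functional \<theta> (laguerre_poly m \<theta> * q) = 0"
  using assms
proof (induction m arbitrary: \<theta> q)
  case (Suc m)
  have "pderiv q = 0 \<or> degree (pderiv q) < m"
    using Suc.prems by (auto simp: degree_pderiv pderiv_eq_0_iff)
  then show ?case
    using Suc laguerre_functional_Suc_mult[of \<theta> m q] by simp
qed auto

section \<open>Norms and the orthogonality relation\<close>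

lemma laguerre_norm_fact: "laguerre_norm m \<theta> = Gamma (real m + \<theta> + 1) / fact m"
  using Gamma_fact[of m, where ?'a = real] by (simp add: laguerre_norm_def add_ac)

text \<open>Transferring the derivative onto the second factor yields the square of degree
  \<open>m\<close> at parameter \<open>\<theta> + 1\<close>, as the two minus signs cancel. The
  norms obey the same recursion: both involve Gamma at \<open>m + \<theta> + 2\<close>, and only the
  factorials differ.\<close>

lemma laguerre_functional_square:
  assumes "\<theta> > -1"
  shows "laguerre_functional \<theta> (laguerre_poly m \<theta> * laguerre_poly m \<theta>) = laguerre_norm m \<theta>"
  using assms
proof (induction m arbitrary: \<theta>)
  case 0
  then show ?case
    using laguerre_functional_monom[of \<theta> 1 0] by (simp add: laguerre_norm_def monom_0 one_pCons)
next
  case (Suc m)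
  have "(real m + 1) * laguerre_functional \<theta> (laguerre_poly (Suc m) \<theta> * laguerre_poly (Suc m) \<theta>)
      = laguerre_functional (\<theta> + 1) (laguerre_poly m (\<theta> + 1) * laguerre_poly m (\<theta> + 1))"
    using laguerre_functional_smult[of "\<theta> + 1" "-1"]
    by (simp add: laguerre_functional_Suc_mult[OF Suc.prems] pderiv_laguerre_poly_Suc)
  also have "\<dots> = laguerre_norm m (\<theta> + 1)"
    using Suc by simp
  also have "\<dots> = (real m + 1) * laguerre_norm (Suc m) \<theta>"
  proof -
    have "fact (Suc m) = (real m + 1) * fact m" by (simp add: algebra_simps)
    moreover have "real (Suc m) + \<theta> + 1 = real m + (\<theta> + 1) + 1" by simp
    ultimately show ?thesis by (simp only: laguerre_norm_fact) (simp add: add_eq_0_iff)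
  qed
  finally show ?case by simp
qed

lemma laguerre_functional_orthogonal:
  assumes "\<theta> > -1"
  shows "laguerre_functional \<theta> (laguerre_poly m \<theta> * laguerre_poly l \<theta>) =
    (if m = l then laguerre_norm m \<theta> else 0)"
proof (cases m l rule: linorder_cases)
  case less
  then show ?thesis
    using laguerre_functional_lower_degree[OF assms, of "laguerre_poly m \<theta>" l] by (simp add: mult.commute)
next
  case greater
  then show ?thesis
    using laguerre_functional_lower_degree[OF assms, of "laguerre_poly l \<theta>" m] by simp
qed (simp add: laguerre_functional_square assms)

lemma laguerre_norm_pos: "\<theta> > -1 \<Longrightarrow> laguerre_norm m \<theta> > 0"
  by (simp add: laguerre_norm_def)

section \<open>Zeros\<close>

text \<open>The raising identity with its weight restored. On the positive axis, zeros of
  \<open>laguerre_poly (Suc m) \<theta>\<close> are thus critical points of a weighted polynomial of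
  degree \<open>m\<close>, ready for Rolle's theorem.\<close>

lemma has_real_derivative_laguerre_raising:
  assumes "y > 0"
  shows "((\<lambda>y. y powr (\<theta> + 1) * exp (-y) * poly (laguerre_poly m (\<theta> + 1)) y) has_real_derivative
    (real m + 1) * (y powr \<theta> * exp (-y)) * poly (laguerre_poly (Suc m) \<theta>) y) (at y)"
proof -
  let ?p = "laguerre_poly m (\<theta> + 1)"
  have "(real m + 1) * poly (laguerre_poly (Suc m) \<theta>) y =
      y * poly (pderiv ?p) y + (\<theta> + 1 - y) * poly ?p y"
    using arg_cong[OF laguerre_poly_raising[of m \<theta>], of "\<lambda>p. poly p y"] by (simp add: algebra_simps)
  then have "(real m + 1) * (y powr \<theta> * exp (-y)) * poly (laguerre_poly (Suc m) \<theta>) y =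
      y powr \<theta> * exp (-y) * (y * poly (pderiv ?p) y + (\<theta> + 1 - y) * poly ?p y)"
    by (simp add: mult_ac)
  moreover have "((\<lambda>y. y powr (\<theta> + 1) * exp (-y) * poly ?p y) has_real_derivative
      y powr \<theta> * exp (-y) * (y * poly (pderiv ?p) y + (\<theta> + 1 - y) * poly ?p y)) (at y)"
  proof (rule DERIV_cong[OF DERIV_mult[OF DERIV_mult poly_DERIV]])
    show "((\<lambda>y. y powr (\<theta> + 1)) has_real_derivative (\<theta> + 1) * y powr \<theta>) (at y)"
      using has_real_derivative_powr[OF assms, of "\<theta> + 1"] by simp
    show "((\<lambda>y. exp (-y)) has_real_derivative - exp (-y)) (at y)"
      by (auto intro!: derivative_eq_intros)
  qed (use assms in \<open>simp add: powr_add algebra_simps\<close>)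
  ultimately show ?thesis by (simp only:)
qed

text \<open>One critical point in each gap between consecutive zeros, adding the zeros in increasing
  order. Keeping \<open>T\<close> below \<open>Max S\<close> makes the point from each new gap, and
  later the one from the unbounded gap, distinct from the earlier ones.\<close>

lemma Rolle_finite:
  fixes f f' :: "real \<Rightarrow> real"
  assumes "finite S" "S \<noteq> {}" "S \<subseteq> {a..}" "\<And>s. s \<in> S \<Longrightarrow> f s = 0"
    and cont: "continuous_on {a..} f"
    and deriv: "\<And>x. x > a \<Longrightarrow> (f has_real_derivative f' x) (at x)"
  obtains T where "finite T" "Suc (card T) = card S" "T \<subseteq> {a<..<Max S}" "\<And>t. t \<in> T \<Longrightarrow> f' t = 0"
proof -
  have "\<exists>T. finite T \<and> Suc (card T) = card S \<and> T \<subseteq> {a<..<Max S} \<and> (\<forall>t\<in>T. f' t = 0)"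
    using assms(1-4)
  proof (induction S rule: finite_linorder_max_induct)
    case (insert b A)
    show ?case
    proof (cases "A = {}")
      case False
      then obtain T where T: "finite T" "Suc (card T) = card A" "T \<subseteq> {a<..<Max A}" "\<forall>t\<in>T. f' t = 0"
        using insert by auto
      have A: "Max A \<in> A" using False insert by simp
      have Mb: "Max A < b" "a \<le> Max A" using A insert by auto
      have Max: "Max (insert b A) = b"
        using Mb insert False by (simp add: Max_insert)
      \<comment> \<open>The new gap lies between \<open>Max A\<close> and \<open>b\<close>. The
        derivative appears as a linear map, so its vanishing is read off at 1.\<close>
      have "\<exists>z. Max A < z \<and> z < b \<and> (*) (f' z) = (\<lambda>v. 0)"
      proof (rule Rolle_deriv)
        show "continuous_on {Max A..b} f"
          using Mb by (intro continuous_on_subset[OF cont]) auto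
        show "(f has_derivative (*) (f' x)) (at x)" if "Max A < x" "x < b" for x
          using deriv[of x] that Mb by (simp add: has_field_derivative_def)
        show "f (Max A) = f b" using A insert.prems by simp
      qed (rule Mb)
      then obtain z where z: "Max A < z" "z < b" "(*) (f' z) = (\<lambda>v. 0)" by blast
      have f'z: "f' z = 0" using fun_cong[OF z(3), of 1] by simp
      have "z \<notin> T" "b \<notin> A" using T z Mb insert by auto
      then have "finite (insert z T) \<and> Suc (card (insert z T)) = card (insert b A)
          \<and> insert z T \<subseteq> {a<..<Max (insert b A)} \<and> (\<forall>t\<in>insert z T. f' t = 0)"
        unfolding Max using T z f'z Mb insert.hyps by auto
      then show ?thesis ..
    qed (auto intro!: exI[of _ "{}"])
  qed simp
  then show ?thesis using that by blast
qed

text \<open>Decay at infinity acts as a second zero: some value is taken twice on the half-line, and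
  the ordinary Rolle theorem applies between the two points.\<close>

lemma Rolle_at_infinity:
  fixes f f' :: "real \<Rightarrow> real"
  assumes "f c = 0" and lim: "(f \<longlongrightarrow> 0) at_top"
    and cont: "continuous_on {c..} f"
    and deriv: "\<And>x. x > c \<Longrightarrow> (f has_real_derivative f' x) (at x)"
  obtains z where "z > c" "f' z = 0"
proof -
  have "\<exists>s t. c \<le> s \<and> s < t \<and> f s = f t"
  proof (cases "f (c + 1) = 0")
    case True
    then show ?thesis using assms(1) by (intro exI[of _ c] exI[of _ "c + 1"]) auto
  next
    case False
    then have "eventually (\<lambda>d. \<bar>f d\<bar> < \<bar>f (c + 1)\<bar>) at_top"
      using tendstoD[OF lim, of "\<bar>f (c + 1)\<bar>"] by (simp add: dist_real_def)
    then obtain d where d: "d \<ge> c + 1" "\<bar>f d\<bar> < \<bar>f (c + 1)\<bar>"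
      unfolding eventually_at_top_linorder by (metis linorder_le_cases order_refl)
    have cont': "continuous_on {a..b} f" if "c \<le> a" for a b
      using that by (intro continuous_on_subset[OF cont]) auto
    \<comment> \<open>The level \<open>max 0 (f d)\<close>, or \<open>min 0 (f d)\<close> when
      \<open>f (c + 1)\<close> is negative, separates \<open>f (c + 1)\<close> from both 0 and
      \<open>f d\<close>. It is therefore attained on each side of \<open>c + 1\<close>, and never
      at \<open>c + 1\<close> itself, so \<open>s < t\<close>.\<close>
    obtain u s t where u: "u \<noteq> f (c + 1)" "c \<le> s" "s \<le> c + 1" "f s = u" "c + 1 \<le> t" "f t = u"
    proof (cases "f (c + 1) > 0")
      case True
      then have "f d < f (c + 1)" using d by linarith
      obtain s where "c \<le> s" "s \<le> c + 1" "f s = max 0 (f d)"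
        using IVT'[of f c "max 0 (f d)" "c + 1"] cont' assms(1) True d \<open>f d < _\<close> by auto
      moreover obtain t where "c + 1 \<le> t" "f t = max 0 (f d)"
        using IVT2'[of f d "max 0 (f d)" "c + 1"] cont' True d \<open>f d < _\<close> by auto
      ultimately show ?thesis using True \<open>f d < _\<close> that[of "max 0 (f d)" s t] by auto
    next
      case F: False
      then have "f (c + 1) < f d" using d by linarith
      obtain s where "c \<le> s" "s \<le> c + 1" "f s = min 0 (f d)"
        using IVT2'[of f "c + 1" "min 0 (f d)" c] cont' assms(1) F d \<open>_ < f d\<close> by auto
      moreover obtain t where "c + 1 \<le> t" "f t = min 0 (f d)"
        using IVT'[of f "c + 1" "min 0 (f d)" d] cont' F d \<open>_ < f d\<close> by auto
      ultimately show ?thesis using F False \<open>_ < f d\<close> that[of "min 0 (f d)" s t] by auto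
    qed
    then have "s \<noteq> c + 1" by auto
    then show ?thesis using u by (intro exI[of _ s] exI[of _ t]) auto
  qed
  then obtain s t where st: "c \<le> s" "s < t" "f s = f t" by blast
  then have "\<exists>z. s < z \<and> z < t \<and> (\<lambda>v. f' z * v) = (\<lambda>v. 0)"
    using deriv by (intro Rolle_deriv[of s t f] continuous_on_subset[OF cont])
      (auto simp: has_field_derivative_def)
  then obtain z where z: "s < z" "(\<lambda>v. f' z * v) = (\<lambda>v. 0)" by blast
  have "f' z = 0" using fun_cong[OF z(2), of 1] by simp
  then show ?thesis using that[of z] st z by simp
qed

lemma tendsto_poly_mult_powr_exp:
  fixes \<theta> :: real
  shows "((\<lambda>y. y powr \<theta> * exp (-y) * poly p y) \<longlongrightarrow> 0) at_top"
proof (induction p rule: poly_monom_induct)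
  case (monom c k)
  have "((\<lambda>y. y powr \<theta> * exp (-y) * (c * y ^ k)) \<longlongrightarrow> 0) at_top"
    by real_asymp
  then show ?case by (simp add: poly_monom)
next
  case (add p q)
  then show ?case using tendsto_add[OF add] by (simp add: algebra_simps)
qed

text \<open>The \<open>m\<close> positive zeros at parameter \<open>\<theta> + 1\<close>, together
  with 0, bound \<open>m\<close> finite gaps and one unbounded gap, giving \<open>m + 1\<close>
  critical points.\<close>

lemma laguerre_poly_positive_roots:
  assumes "\<theta> > -1"
  shows "\<exists>T. finite T \<and> card T = m \<and> T \<subseteq> {0<..} \<and> (\<forall>t\<in>T. poly (laguerre_poly m \<theta>) t = 0)"
  using assms
proof (induction m arbitrary: \<theta>)
  case (Suc m)
  define f where "f = (\<lambda>y. y powr (\<theta> + 1) * exp (-y) * poly (laguerre_poly m (\<theta> + 1)) y)"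
  define f' where "f' = (\<lambda>y. (real m + 1) * (y powr \<theta> * exp (-y)) * poly (laguerre_poly (Suc m) \<theta>) y)"
  obtain T where T: "finite T" "card T = m" "T \<subseteq> {0<..}"
      "\<forall>t\<in>T. poly (laguerre_poly m (\<theta> + 1)) t = 0"
    using Suc.IH[of "\<theta> + 1"] Suc.prems by auto
  have deriv: "(f has_real_derivative f' y) (at y)" if "y > 0" for y
    unfolding f_def f'_def using has_real_derivative_laguerre_raising[OF that] .
  \<comment> \<open>The exponent \<open>\<theta> + 1\<close> is positive, so \<open>f\<close> is
    continuous up to 0 and vanishes there.\<close>
  have cont: "continuous_on {0..} f"
    unfolding f_def using Suc.prems by (intro continuous_intros continuous_on_powr') auto
  let ?S = "insert 0 T"
  have fS: "f s = 0" if "s \<in> ?S" for s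
    using that T by (auto simp: f_def)
  have M: "Max ?S \<in> ?S" "0 \<le> Max ?S" using T Max_in[of ?S] Max_ge[of ?S 0] by auto
  obtain U where U: "finite U" "Suc (card U) = card ?S" "U \<subseteq> {0<..<Max ?S}"
      "\<And>t. t \<in> U \<Longrightarrow> f' t = 0"
  proof (rule Rolle_finite[of ?S 0 f f'])
    show "?S \<subseteq> {0..}" using T by (auto simp: less_imp_le)
  qed (use T fS cont deriv in blast)+
  obtain z where z: "z > Max ?S" "f' z = 0"
  proof (rule Rolle_at_infinity[of f "Max ?S" f'])
    show "f (Max ?S) = 0" using fS M by blast
    show "(f \<longlongrightarrow> 0) at_top" unfolding f_def by (rule tendsto_poly_mult_powr_exp)
    show "continuous_on {Max ?S..} f" using M by (intro continuous_on_subset[OF cont]) auto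
  qed (use deriv M in auto)
  have "poly (laguerre_poly (Suc m) \<theta>) t = 0" if "f' t = 0" "t > 0" for t
    using that by (simp add: f'_def)
  moreover have "0 \<notin> T" using T by auto
  moreover have "z \<notin> U" using U(3) z(1) by (meson greaterThanLessThan_iff less_asym subsetD)
  ultimately have "finite (insert z U) \<and> card (insert z U) = Suc m \<and> insert z U \<subseteq> {0<..} \<and>
      (\<forall>t\<in>insert z U. poly (laguerre_poly (Suc m) \<theta>) t = 0)"
    using U z M T by (auto simp: card_insert_if)
  then show ?case ..
qed auto

text \<open>The degree bounds the number of roots, so the positive zeros already found are all of
  them.\<close>

lemma laguerre_poly_roots:
  fixes m :: nat
  assumes "\<theta> > -1"
  defines "R \<equiv> {y. poly (laguerre_poly m \<theta>) y = 0}"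
  shows "finite R" "card R = m" "R \<subseteq> {0<..}"
proof -
  obtain T where T: "finite T" "card T = m" "T \<subseteq> {0<..}" "\<forall>t\<in>T. poly (laguerre_poly m \<theta>) t = 0"
    using laguerre_poly_positive_roots[OF assms(1)] by blast
  show fin: "finite R" unfolding R_def by (rule poly_roots_finite) simp
  have "card R \<le> m"
    using card_poly_roots_bound[of "laguerre_poly m \<theta>"] by (simp add: R_def)
  moreover have "T \<subseteq> R" using T by (auto simp: R_def)
  ultimately have "T = R" using T fin by (intro card_seteq) auto
  then show "card R = m" "R \<subseteq> {0<..}" using T by auto
qed

section \<open>Gauss quadrature\<close>

text \<open>The reproducing kernel of the polynomials of degree at most \<open>M\<close>, as a
  polynomial in one variable with the other fixed at \<open>z\<close>.\<close>

definition laguerre_kernel :: "real \<Rightarrow> nat \<Rightarrow> real \<Rightarrow> real poly" where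
  "laguerre_kernel \<theta> M z =
     (\<Sum>k\<le>M. smult (poly (laguerre_poly k \<theta>) z / laguerre_norm k \<theta>) (laguerre_poly k \<theta>))"

lemma degree_laguerre_kernel: "degree (laguerre_kernel \<theta> M z) \<le> M"
  unfolding laguerre_kernel_def
  by (intro degree_sum_le) (auto intro: order_trans[OF degree_smult_le])

text \<open>The functional pairs each term with the constant
  \<open>laguerre_poly 0 \<theta>\<close>, so only \<open>k = 0\<close> survives.\<close>

lemma laguerre_functional_kernel:
  assumes "\<theta> > -1"
  shows "laguerre_functional \<theta> (laguerre_kernel \<theta> M z) = 1"
proof -
  have "laguerre_functional \<theta> (laguerre_kernel \<theta> M z) =
      (\<Sum>k\<le>M. if k = 0 then poly (laguerre_poly k \<theta>) z / laguerre_norm k \<theta> * laguerre_norm k \<theta> else 0)"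
    unfolding laguerre_kernel_def laguerre_functional_sum[OF assms] laguerre_functional_smult
    using laguerre_functional_orthogonal[OF assms, of _ 0] by (intro sum.cong) auto
  also have "\<dots> = 1"
    using laguerre_norm_pos[OF assms, of 0] by simp
  finally show ?thesis .
qed

lemma laguerre_norm_Suc:
  assumes "\<theta> > -1"
  shows "(real m + 1) * laguerre_norm (Suc m) \<theta> = (real m + 1 + \<theta>) * laguerre_norm m \<theta>"
proof -
  have "Gamma (real m + \<theta> + 2) = (real m + \<theta> + 1) * Gamma (real m + \<theta> + 1)"
    using Gamma_plus1[of "real m + \<theta> + 1"] assms by (simp add: nonpos_Ints_def add_ac)
  then show ?thesis
    by (simp add: laguerre_norm_fact divide_simps add_ac)
qed

text \<open>Denominators are cleared so that the identity also holds at \<open>x = z\<close>, where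
  it can be differentiated. The induction adds one kernel term and uses the three-term recurrence at
  \<open>x\<close> and at \<open>z\<close>.\<close>

lemma Christoffel_Darboux_laguerre:
  assumes "\<theta> > -1"
  shows "laguerre_norm M \<theta> * ((x - z) * poly (laguerre_kernel \<theta> M z) x) =
    - (real M + 1) * (poly (laguerre_poly (Suc M) \<theta>) x * poly (laguerre_poly M \<theta>) z
      - poly (laguerre_poly M \<theta>) x * poly (laguerre_poly (Suc M) \<theta>) z)"
proof (induction M)
  case 0
  have "poly (laguerre_poly (Suc 0) \<theta>) y = \<theta> + 1 - y" for y
    using arg_cong[OF laguerre_poly_mult_X[of 0 \<theta>], of "\<lambda>p. poly p y"] by simp
  then show ?case using laguerre_norm_pos[OF assms, of 0]
    by (simp add: laguerre_kernel_def)
next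
  case (Suc M)
  let ?h = "laguerre_norm M \<theta>" and ?h' = "laguerre_norm (Suc M) \<theta>"
  let ?K = "poly (laguerre_kernel \<theta> M z) x"
  let ?L = "\<lambda>k. poly (laguerre_poly k \<theta>)"
  let ?W = "?L (Suc M) x * ?L M z - ?L M x * ?L (Suc M) z"
  have h: "?h > 0" "?h' > 0" using laguerre_norm_pos[OF assms] by auto
  have "poly (laguerre_kernel \<theta> (Suc M) z) x = ?K + ?L (Suc M) z / ?h' * ?L (Suc M) x"
    by (simp add: laguerre_kernel_def)
  then have "?h' * ((x - z) * poly (laguerre_kernel \<theta> (Suc M) z) x) =
      ?h' * ((x - z) * ?K) + (x - z) * (?L (Suc M) x * ?L (Suc M) z)"
    using h by (simp add: field_simps)
  also have "?h' * ((x - z) * ?K) = - (real M + 1 + \<theta>) * ?W"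
  proof -
    \<comment> \<open>The ratio of consecutive norms rescales the induction hypothesis from
      \<open>?h\<close> to \<open>?h'\<close>.\<close>
    have "(real M + 1) * (?h' * ((x - z) * ?K)) = (real M + 1 + \<theta>) * (?h * ((x - z) * ?K))"
      using laguerre_norm_Suc[OF assms, of M] by algebra
    also have "\<dots> = (real M + 1) * (- (real M + 1 + \<theta>) * ?W)"
      unfolding Suc.IH by (simp only: mult_ac mult_minus_left mult_minus_right)
    finally show ?thesis by simp
  qed
  also have "- (real M + 1 + \<theta>) * ?W + (x - z) * (?L (Suc M) x * ?L (Suc M) z) =
      - (real (Suc M) + 1) * (?L (Suc (Suc M)) x * ?L (Suc M) z - ?L (Suc M) x * ?L (Suc (Suc M)) z)"
    using laguerre_poly_recurrence[of M \<theta> x] laguerre_poly_recurrence[of M \<theta> z]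
    unfolding of_nat_Suc by algebra
  finally show ?case .
qed

text \<open>The Gauss weight as a function of the zero itself, so that the quadrature sum can run
  over the root set without an enumeration.\<close>

definition laguerre_quad_weight :: "real \<Rightarrow> nat \<Rightarrow> real \<Rightarrow> real" where
  "laguerre_quad_weight \<theta> M z =
     Gamma (real M + \<theta> + 1) / ((real M + \<theta> + 1) * fact (M + 1)) *
     (z / (poly (laguerre_poly M \<theta>) z)\<^sup>2)"

text \<open>For distinct roots the right side of Christoffel-Darboux vanishes. On the diagonal its
  derivative gives the kernel value, which the weight inverts.\<close>

lemma laguerre_kernel_at_roots:
  assumes "\<theta> > -1" and z: "poly (laguerre_poly (Suc M) \<theta>) z = 0"
    and x: "poly (laguerre_poly (Suc M) \<theta>) x = 0"
  shows "laguerre_quad_weight \<theta> M z * poly (laguerre_kernel \<theta> M z) x = (if x = z then 1 else 0)"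
proof (cases "x = z")
  case False
  then show ?thesis
    using Christoffel_Darboux_laguerre[OF assms(1), of M x z] z x laguerre_norm_pos[OF assms(1), of M]
    by auto
next
  case True
  let ?K = "laguerre_kernel \<theta> M z" and ?h = "laguerre_norm M \<theta>" and ?l = "poly (laguerre_poly M \<theta>) z"
  have h: "?h > 0" using laguerre_norm_pos[OF assms(1)] .
  have z0: "z > 0" using laguerre_poly_roots(3)[OF assms(1), of "Suc M"] z by auto
  \<comment> \<open>Since \<open>z\<close> is a root, Christoffel-Darboux becomes a polynomial
    identity; differentiating it at \<open>z\<close> replaces the limit \<open>x\<close> to
    \<open>z\<close>.\<close>
  have "smult ?h ([:-z, 1:] * ?K) = smult (- (real M + 1) * ?l) (laguerre_poly (Suc M) \<theta>)"
    using Christoffel_Darboux_laguerre[OF assms(1), of M _ z] z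
    by (intro poly_ext) (simp add: algebra_simps)
  from arg_cong[OF this, of "\<lambda>p. poly (pderiv p) z"]
  have "?h * poly ?K z = - (real M + 1) * ?l * poly (pderiv (laguerre_poly (Suc M) \<theta>)) z"
    by (simp only: pderiv_smult pderiv_mult) (simp add: pderiv_pCons)
  then have "?h * (z * poly ?K z) = - (real M + 1) * ?l * (z * poly (pderiv (laguerre_poly (Suc M) \<theta>)) z)"
    by algebra
  also have "z * poly (pderiv (laguerre_poly (Suc M) \<theta>)) z = - (real M + 1 + \<theta>) * ?l"
    using poly_pderiv_laguerre_poly_Suc[of z M \<theta>] z by (simp add: algebra_simps)
  also have "- (real M + 1) * ?l * (- (real M + 1 + \<theta>) * ?l) = (real M + 1) * (real M + 1 + \<theta>) * ?l\<^sup>2"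
    by (simp only: power2_eq_square mult_minus_left mult_minus_right minus_minus mult_ac)
  finally have K: "?h * (z * poly ?K z) = (real M + 1) * (real M + 1 + \<theta>) * ?l\<^sup>2" .
  \<comment> \<open>The diagonal kernel is a sum of squares whose term \<open>k = 0\<close> is
    positive. By \<open>K\<close> this forces \<open>?l\<close> to be nonzero, so the weight has no
    zero denominator.\<close>
  have "poly ?K z = (\<Sum>k\<le>M. (poly (laguerre_poly k \<theta>) z)\<^sup>2 / laguerre_norm k \<theta>)"
    by (simp add: laguerre_kernel_def poly_sum power2_eq_square)
  also have "\<dots> > 0"
  proof (rule sum_pos2[of _ 0])
    show "0 \<le> (poly (laguerre_poly k \<theta>) z)\<^sup>2 / laguerre_norm k \<theta>" for k
      using laguerre_norm_pos[OF assms(1), of k] by simp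
  qed (use laguerre_norm_pos[OF assms(1)] in auto)
  finally have "?l \<noteq> 0" using K h z0 by auto
  moreover have "laguerre_quad_weight \<theta> M z = ?h * z / ((real M + 1) * (real M + 1 + \<theta>) * ?l\<^sup>2)"
    by (simp add: laguerre_quad_weight_def laguerre_norm_fact add_ac mult_ac)
  ultimately show ?thesis
    using K True assms(1) by (simp add: mult_ac add_eq_0_iff)
qed

text \<open>Divide \<open>p\<close> by the nodal polynomial. The quotient has degree at most
  \<open>M\<close>, so its part integrates to 0 by orthogonality and also vanishes at the nodes; the
  remainder is integrated exactly by interpolation.\<close>

lemma laguerre_gauss_quadrature:
  assumes "\<theta> > -1" and deg: "degree p \<le> 2 * M + 1"
  shows "laguerre_functional \<theta> p =
    (\<Sum>z | poly (laguerre_poly (Suc M) \<theta>) z = 0. poly p z * laguerre_quad_weight \<theta> M z)"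
proof -
  let ?L = "laguerre_poly (Suc M) \<theta>"
  define R where "R = {z. poly ?L z = 0}"
  define s where "s = p div ?L"
  define r where "r = p mod ?L"
  have R: "finite R" "card R = Suc M"
    unfolding R_def using laguerre_poly_roots[OF assms(1)] by auto
  have p: "p = ?L * s + r" by (simp add: s_def r_def)
  have r: "degree r \<le> M"
    using degree_mod_less[of ?L p] by (auto simp: r_def)
  have s: "s = 0 \<or> degree s < Suc M"
  proof (rule disjCI)
    assume "\<not> degree s < Suc M"
    have "degree (?L * s) \<le> 2 * M + 1"
      using p deg r degree_diff_le[of p "2 * M + 1" r] by simp
    then show "s = 0"
      using \<open>\<not> degree s < Suc M\<close> degree_mult_eq[of ?L s] by auto
  qed
  \<comment> \<open>Weighted kernels form the Lagrange basis. Both sides have degree at most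
    \<open>M\<close> and agree at \<open>M + 1\<close> points.\<close>
  have "r = (\<Sum>z\<in>R. smult (poly r z * laguerre_quad_weight \<theta> M z) (laguerre_kernel \<theta> M z))"
    (is "r = ?I")
  proof (rule poly_eqI_degree[of R])
    fix x assume x: "x \<in> R"
    have "poly ?I x = (\<Sum>z\<in>R. poly r z * (laguerre_quad_weight \<theta> M z * poly (laguerre_kernel \<theta> M z) x))"
      by (simp add: poly_sum mult.assoc)
    also have "\<dots> = (\<Sum>z\<in>R. if z = x then poly r z else 0)"
      using x laguerre_kernel_at_roots[OF assms(1)] by (intro sum.cong) (auto simp: R_def)
    finally show "poly r x = poly ?I x" using x R by simp
  next
    have "degree ?I \<le> M"
      by (intro degree_sum_le order_trans[OF degree_smult_le] degree_laguerre_kernel R)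
    then show "degree ?I < card R" using R by simp
  qed (use r R in simp)
  then have "laguerre_functional \<theta> r = laguerre_functional \<theta> ?I" by (rule arg_cong)
  also have "\<dots> = (\<Sum>z\<in>R. poly r z * laguerre_quad_weight \<theta> M z)"
    by (simp add: laguerre_functional_sum laguerre_functional_smult laguerre_functional_kernel assms(1))
  also have "\<dots> = (\<Sum>z\<in>R. poly p z * laguerre_quad_weight \<theta> M z)"
    by (intro sum.cong) (auto simp: p R_def simp del: mult_eq_0_iff)
  finally have "laguerre_functional \<theta> r = (\<Sum>z\<in>R. poly p z * laguerre_quad_weight \<theta> M z)" .
  moreover have "laguerre_functional \<theta> p = laguerre_functional \<theta> r"
    using laguerre_functional_lower_degree[OF assms(1) s]
    by (subst p) (simp add: laguerre_functional_add assms(1))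
  ultimately show ?thesis by (simp add: R_def)
qed

section \<open>The fractional substitution\<close>

text \<open>Exhibits the weight as the derivative of \<open>(\<beta> + 1) * x powr \<gamma>\<close>
  times the Laguerre weight at that point, the form required by the change of variables.\<close>

lemma sfl_weight_eq:
  assumes \<beta>: "\<beta> > -1" and "x > 0"
  shows "sfl_weight \<theta> \<beta> \<gamma> x = (\<beta> + 1) * (\<gamma> * x powr (\<gamma> - 1)) *
    (((\<beta> + 1) * x powr \<gamma>) powr \<theta> * exp (- ((\<beta> + 1) * x powr \<gamma>)))"
proof -
  have "x powr (\<gamma> * (\<theta> + 1) - 1) = x powr (\<gamma> - 1) * (x powr \<gamma>) powr \<theta>"
    by (simp add: powr_powr powr_add[symmetric] algebra_simps)
  moreover have "(\<beta> + 1) powr (\<theta> + 1) = (\<beta> + 1) * (\<beta> + 1) powr \<theta>"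
    using \<beta> by (simp add: powr_add)
  moreover have "((\<beta> + 1) * x powr \<gamma>) powr \<theta> = (\<beta> + 1) powr \<theta> * (x powr \<gamma>) powr \<theta>"
    using \<beta> by (simp add: powr_mult)
  moreover have "- (\<beta> + 1) * x powr \<gamma> = - ((\<beta> + 1) * x powr \<gamma>)"
    by (simp add: algebra_simps)
  ultimately show ?thesis
    unfolding sfl_weight_def by (simp only: mult_ac)
qed

lemma sfl_weight_pos: "\<beta> > -1 \<Longrightarrow> \<gamma> > 0 \<Longrightarrow> x > 0 \<Longrightarrow> sfl_weight \<theta> \<beta> \<gamma> x > 0"
  by (simp add: sfl_weight_def)

lemma has_real_derivative_scaled_powr:
  assumes "x > 0"
  shows "((\<lambda>x. (\<beta> + 1) * x powr \<gamma>) has_real_derivative (\<beta> + 1) * (\<gamma> * x powr (\<gamma> - 1))) (at x)"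
  using has_real_derivative_powr[OF assms] by (rule DERIV_cmult)

lemma laguerre_functional_substitution:
  fixes \<theta> \<beta> \<gamma> :: real
  assumes \<theta>: "\<theta> > -1" and \<beta>: "\<beta> > -1" and \<gamma>: "\<gamma> > 0"
  shows "set_integrable lborel {0<..} (\<lambda>x. poly p ((\<beta> + 1) * x powr \<gamma>) * sfl_weight \<theta> \<beta> \<gamma> x)"
    and "(LBINT x:{0<..}. poly p ((\<beta> + 1) * x powr \<gamma>) * sfl_weight \<theta> \<beta> \<gamma> x) =
      laguerre_functional \<theta> p"
proof -
  define f where "f = (\<lambda>y. poly p y * (y powr \<theta> * exp (-y)))"
  define g where "g = (\<lambda>x. (\<beta> + 1) * x powr \<gamma>)"
  define g' where "g' = (\<lambda>x. (\<beta> + 1) * (\<gamma> * x powr (\<gamma> - 1)))"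
  have [measurable]: "poly p \<in> borel_measurable borel"
    by (intro borel_measurable_continuous_onI continuous_intros)
  have f_meas [measurable]: "f \<in> borel_measurable borel"
    unfolding f_def by measurable
  have f_int: "set_integrable lborel {0<..} f"
    unfolding f_def by (rule set_integrable_poly_laguerre_weight[OF \<theta>])
  then have f_ai: "f absolutely_integrable_on {0<..}"
    unfolding set_integrable_def by (subst integrable_completion) simp_all
  have f_val: "integral {0<..} f = laguerre_functional \<theta> p"
    using set_borel_integral_eq_integral(2)[OF f_int] by (simp add: laguerre_functional_def f_def)
  \<comment> \<open>The preimage of \<open>y\<close> is given by the formula that also defines
    \<open>sfl_node\<close>.\<close>
  have img: "g ` {0<..} = {0<..}"
  proof (intro equalityI subsetI)
    fix y :: real assume "y \<in> {0<..}"
    then have "y = g ((y / (\<beta> + 1)) powr (1 / \<gamma>))" "(y / (\<beta> + 1)) powr (1 / \<gamma>) \<in> {0<..}"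
      using \<beta> \<gamma> by (auto simp: g_def powr_powr)
    then show "y \<in> g ` {0<..}" by (rule image_eqI)
  qed (use \<beta> in \<open>auto simp: g_def\<close>)
  have inj: "inj_on g {0<..}"
  proof (rule inj_onI)
    fix x y :: real assume "x \<in> {0<..}" "y \<in> {0<..}" "g x = g y"
    then show "x = y"
      using powr_inj[of x \<gamma>] \<beta> \<gamma> by (simp add: g_def) (metis powr_less_mono2 less_imp_le not_less_iff_gr_or_eq)
  qed
  have "(\<lambda>x. \<bar>g' x\<bar> * f (g x)) absolutely_integrable_on {0<..} \<and>
      integral {0<..} (\<lambda>x. \<bar>g' x\<bar> * f (g x)) = laguerre_functional \<theta> p"
  proof (subst has_absolute_integral_change_of_variables_1'[OF _ _ inj])
    show "(g has_real_derivative g' x) (at x within {0<..})" if "x \<in> {0<..}" for x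
      unfolding g_def g'_def using that
      by (intro DERIV_subset[OF has_real_derivative_scaled_powr]) auto
    show "f absolutely_integrable_on g ` {0<..} \<and> integral (g ` {0<..}) f = laguerre_functional \<theta> p"
      unfolding img using f_ai f_val by simp
  qed simp
  then have ai: "(\<lambda>x. \<bar>g' x\<bar> * f (g x)) absolutely_integrable_on {0<..}"
    and val: "integral {0<..} (\<lambda>x. \<bar>g' x\<bar> * f (g x)) = laguerre_functional \<theta> p"
    by auto
  have meas: "(\<lambda>x. \<bar>g' x\<bar> * f (g x)) \<in> borel_measurable borel"
    unfolding g_def g'_def by measurable
  have eq: "poly p ((\<beta> + 1) * x powr \<gamma>) * sfl_weight \<theta> \<beta> \<gamma> x = \<bar>g' x\<bar> * f (g x)"
    if "x \<in> {0<..}" for x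
    using that \<beta> \<gamma> by (simp add: sfl_weight_eq f_def g_def g'_def)
  note lb = set_integrable_lborel_of_absolutely_integrable[OF ai _ meas]
  show "set_integrable lborel {0<..} (\<lambda>x. poly p ((\<beta> + 1) * x powr \<gamma>) * sfl_weight \<theta> \<beta> \<gamma> x)"
    using lb(1) by (subst set_integrable_cong[OF refl refl eq]) simp_all
  show "(LBINT x:{0<..}. poly p ((\<beta> + 1) * x powr \<gamma>) * sfl_weight \<theta> \<beta> \<gamma> x) = laguerre_functional \<theta> p"
    using lb(2) val eq by (subst set_lebesgue_integral_cong[where g = "\<lambda>x. \<bar>g' x\<bar> * f (g x)"]) auto
qed

section \<open>Derivatives and flux of the fractional functions\<close>

lemma sfl_eq_poly: "sfl m \<theta> \<beta> \<gamma> x = poly (laguerre_poly m \<theta>) ((\<beta> + 1) * x powr \<gamma>)"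
  by (simp add: sfl_def poly_laguerre_poly)

lemma sfl_has_real_derivative:
  assumes "x > 0"
  shows "(sfl m \<theta> \<beta> \<gamma> has_real_derivative
    poly (pderiv (laguerre_poly m \<theta>)) ((\<beta> + 1) * x powr \<gamma>) * ((\<beta> + 1) * (\<gamma> * x powr (\<gamma> - 1)))) (at x)"
  unfolding sfl_eq_poly[abs_def]
  by (rule DERIV_chain2[OF poly_DERIV has_real_derivative_scaled_powr[OF assms]])

text \<open>The powers of \<open>x\<close> and of \<open>\<beta> + 1\<close> recombine into
  \<open>y powr (\<theta> + 1)\<close>, so the flux is a multiple of the function whose derivative
  the raising identity supplies.\<close>

lemma sfl_flux_Suc:
  fixes \<beta> \<gamma> x :: real
  assumes "\<beta> > -1" "x > 0"
  defines "y \<equiv> (\<beta> + 1) * x powr \<gamma>"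
  shows "sfl_flux (Suc m) \<theta> \<beta> \<gamma> x =
    - \<gamma> * (y powr (\<theta> + 1) * exp (-y) * poly (laguerre_poly m (\<theta> + 1)) y)"
proof -
  have "deriv (sfl (Suc m) \<theta> \<beta> \<gamma>) x =
      - poly (laguerre_poly m (\<theta> + 1)) y * ((\<beta> + 1) * (\<gamma> * x powr (\<gamma> - 1)))"
    using DERIV_imp_deriv[OF sfl_has_real_derivative[OF assms(2)], of "Suc m" \<theta> \<beta> \<gamma>]
    by (simp add: pderiv_laguerre_poly_Suc y_def)
  moreover have "x powr (\<gamma> * \<theta> + 1) * x powr (\<gamma> - 1) = (x powr \<gamma>) powr (\<theta> + 1)"
    by (simp add: powr_powr powr_add[symmetric] algebra_simps)
  moreover have "y powr (\<theta> + 1) = (\<beta> + 1) * (\<beta> + 1) powr \<theta> * (x powr \<gamma>) powr (\<theta> + 1)"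
    using assms by (simp add: y_def powr_mult powr_add)
  moreover have "- (\<beta> + 1) * x powr \<gamma> = - y"
    by (simp add: y_def algebra_simps)
  ultimately show ?thesis
    unfolding sfl_flux_def by algebra
qed

lemma sfl_flux_Suc_has_real_derivative:
  assumes "\<beta> > -1" "x > 0"
  shows "(sfl_flux (Suc m) \<theta> \<beta> \<gamma> has_real_derivative
    - \<gamma> * (real m + 1) * sfl (Suc m) \<theta> \<beta> \<gamma> x * sfl_weight \<theta> \<beta> \<gamma> x) (at x)"
proof -
  let ?F = "\<lambda>y. y powr (\<theta> + 1) * exp (-y) * poly (laguerre_poly m (\<theta> + 1)) y"
  let ?g = "\<lambda>x. (\<beta> + 1) * x powr \<gamma>"
  have "?g x > 0" using assms by simp
  from DERIV_cmult[OF DERIV_chain2[OF has_real_derivative_laguerre_raising[OF this, of \<theta> m]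
      has_real_derivative_scaled_powr[OF assms(2)]], of "- \<gamma>"]
  have "((\<lambda>x. - \<gamma> * ?F (?g x)) has_real_derivative
      - \<gamma> * (real m + 1) * sfl (Suc m) \<theta> \<beta> \<gamma> x * sfl_weight \<theta> \<beta> \<gamma> x) (at x)"
    using assms by (simp only: sfl_weight_eq sfl_eq_poly mult_ac)
  \<comment> \<open>The closed form of the flux is known only for positive arguments, an open set
    around \<open>x\<close>.\<close>
  then show ?thesis
    by (rule has_field_derivative_transform_within_open[of _ _ _ "{0<..}"])
      (use assms in \<open>auto simp: sfl_flux_Suc\<close>)
qed

text \<open>There are exactly \<open>M + 1\<close> roots, so the sorted list enumerates them
  bijectively by the indices \<open>0..M\<close>.\<close>

lemma sum_laguerre_nodes:
  assumes "\<theta> > -1"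
  shows "(\<Sum>i=0..M. F (laguerre_node \<theta> M i)) =
    (\<Sum>z | poly (laguerre_poly (Suc M) \<theta>) z = 0. F z)"
proof -
  define R where "R = {z. poly (laguerre_poly (Suc M) \<theta>) z = 0}"
  have R: "finite R" "card R = Suc M"
    unfolding R_def using laguerre_poly_roots[OF assms] by auto
  have "bij_betw ((!) (sorted_list_of_set R)) {0..M} R"
    using R by (intro bij_betw_nth) auto
  moreover have "laguerre_node \<theta> M i = sorted_list_of_set R ! i" for i
    by (simp add: laguerre_node_def R_def poly_laguerre_poly)
  ultimately show ?thesis
    unfolding R_def[symmetric] by (simp add: sum.reindex_bij_betw)
qed

lemma laguerre_node_pos:
  assumes "\<theta> > -1" "i \<le> M"
  shows "laguerre_node \<theta> M i > 0"
proof -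
  define R where "R = {z. poly (laguerre_poly (Suc M) \<theta>) z = 0}"
  have R: "finite R" "card R = Suc M" "R \<subseteq> {0<..}"
    unfolding R_def using laguerre_poly_roots[OF assms(1)] by auto
  have "sorted_list_of_set R ! i \<in> set (sorted_list_of_set R)"
    using R assms by (intro nth_mem) simp
  then show ?thesis
    using R by (auto simp: laguerre_node_def R_def[symmetric] poly_laguerre_poly[symmetric])
qed

lemma laguerre_weight_eq: "laguerre_weight \<theta> M i = laguerre_quad_weight \<theta> M (laguerre_node \<theta> M i)"
  by (simp add: laguerre_weight_def laguerre_quad_weight_def poly_laguerre_poly)

lemma frac_poly_space_poly:
  assumes "\<beta> > -1" "q \<in> frac_poly_space \<gamma> N"
  obtains p where "degree p \<le> N" "\<And>x. x > 0 \<Longrightarrow> q x = poly p ((\<beta> + 1) * x powr \<gamma>)"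
proof -
  obtain c where c: "\<And>x. x > 0 \<Longrightarrow> q x = (\<Sum>k\<le>N. c k * x powr (real k * \<gamma>))"
    using assms(2) by (auto simp: frac_poly_space_def)
  \<comment> \<open>Dividing by \<open>(\<beta> + 1) ^ k\<close> undoes the scaling of the
    argument.\<close>
  let ?p = "\<Sum>k\<le>N. monom (c k / (\<beta> + 1) ^ k) k"
  have "degree ?p \<le> N"
    by (intro degree_sum_le) (auto intro: order_trans[OF degree_monom_le])
  moreover have "q x = poly ?p ((\<beta> + 1) * x powr \<gamma>)" if "x > 0" for x
    using that assms(1) by (simp add: c poly_sum poly_monom power_mult_distrib powr_power)
  ultimately show ?thesis by (rule that)
qed

section \<open>Recurrence, mapped derivative and quadrature for the fractional functions\<close>

lemma sfl_recurrence:
  "sfl (Suc (Suc m)) \<theta> \<beta> \<gamma> x =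
     (2 * real (Suc m) + \<theta> + 1 - (\<beta> + 1) * x powr \<gamma>) / (real (Suc m) + 1) * sfl (Suc m) \<theta> \<beta> \<gamma> x
     - (real (Suc m) + \<theta>) / (real (Suc m) + 1) * sfl m \<theta> \<beta> \<gamma> x"
  using laguerre_poly_recurrence[of m \<theta> "(\<beta> + 1) * x powr \<gamma>"]
  by (simp add: sfl_eq_poly divide_simps) (simp add: algebra_simps)

lemma mapped_deriv_sfl_Suc:
  assumes "\<beta> > -1" "\<gamma> > 0" "x > 0"
  shows "- mapped_deriv \<beta> \<gamma> (sfl (Suc m) \<theta> \<beta> \<gamma>) x = sfl m (\<theta> + 1) \<beta> \<gamma> x"
proof -
  have d: "deriv (sfl (Suc m) \<theta> \<beta> \<gamma>) x =
      - sfl m (\<theta> + 1) \<beta> \<gamma> x * ((\<beta> + 1) * (\<gamma> * x powr (\<gamma> - 1)))"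
    using DERIV_imp_deriv[OF sfl_has_real_derivative[OF assms(3)], of "Suc m" \<theta> \<beta> \<gamma>]
    by (simp add: pderiv_laguerre_poly_Suc sfl_eq_poly)
  have "- mapped_deriv \<beta> \<gamma> (sfl (Suc m) \<theta> \<beta> \<gamma>) x =
      (x powr (1 - \<gamma>) * x powr (\<gamma> - 1)) * sfl m (\<theta> + 1) \<beta> \<gamma> x"
    using assms unfolding mapped_deriv_def d by simp
  also have "x powr (1 - \<gamma>) * x powr (\<gamma> - 1) = 1"
    using assms by (simp flip: powr_add)
  finally show ?thesis by simp
qed

lemma sfl_quadrature:
  assumes \<theta>: "\<theta> > -1" and \<beta>: "\<beta> > -1" and \<gamma>: "\<gamma> > 0" and q: "q \<in> frac_poly_space \<gamma> (2 * M + 1)"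
  shows "set_integrable lborel {0<..} (\<lambda>x. q x * sfl_weight \<theta> \<beta> \<gamma> x)"
    and "(LBINT x:{0<..}. q x * sfl_weight \<theta> \<beta> \<gamma> x) =
      (\<Sum>i=0..M. q (sfl_node \<theta> \<beta> \<gamma> M i) * laguerre_weight \<theta> M i)"
proof -
  obtain p where deg: "degree p \<le> 2 * M + 1" and
    p: "\<And>x. x > 0 \<Longrightarrow> q x = poly p ((\<beta> + 1) * x powr \<gamma>)"
    using frac_poly_space_poly[OF \<beta> q] by blast
  have eq: "q x * sfl_weight \<theta> \<beta> \<gamma> x = poly p ((\<beta> + 1) * x powr \<gamma>) * sfl_weight \<theta> \<beta> \<gamma> x"
    if "x \<in> {0<..}" for x
    using that p by simp
  show "set_integrable lborel {0<..} (\<lambda>x. q x * sfl_weight \<theta> \<beta> \<gamma> x)"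
    using laguerre_functional_substitution(1)[OF \<theta> \<beta> \<gamma>, of p]
    by (subst set_integrable_cong[OF refl refl eq]) simp_all
  \<comment> \<open>Positivity of the node is essential: \<open>q\<close> is a polynomial in
    \<open>x powr \<gamma>\<close> only for positive \<open>x\<close>, and there the two powers are
    inverse to each other.\<close>
  have node: "q (sfl_node \<theta> \<beta> \<gamma> M i) = poly p (laguerre_node \<theta> M i)" if "i \<le> M" for i
  proof -
    have "laguerre_node \<theta> M i > 0" using laguerre_node_pos[OF \<theta> that] .
    then have "sfl_node \<theta> \<beta> \<gamma> M i > 0"
      "(\<beta> + 1) * sfl_node \<theta> \<beta> \<gamma> M i powr \<gamma> = laguerre_node \<theta> M i"
      using \<beta> \<gamma> by (auto simp: sfl_node_def powr_powr)
    then show ?thesis using p by simp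
  qed
  have "(LBINT x:{0<..}. q x * sfl_weight \<theta> \<beta> \<gamma> x) = laguerre_functional \<theta> p"
    using laguerre_functional_substitution(2)[OF \<theta> \<beta> \<gamma>, of p] eq
    by (subst set_lebesgue_integral_cong) auto
  also have "\<dots> = (\<Sum>i=0..M. poly p (laguerre_node \<theta> M i) * laguerre_weight \<theta> M i)"
    unfolding laguerre_weight_eq sum_laguerre_nodes[OF \<theta>, of "\<lambda>z. poly p z * laguerre_quad_weight \<theta> M z" M]
    by (rule laguerre_gauss_quadrature[OF \<theta> deg])
  also have "\<dots> = (\<Sum>i=0..M. q (sfl_node \<theta> \<beta> \<gamma> M i) * laguerre_weight \<theta> M i)"
    by (intro sum.cong) (auto simp: node)
  finally show "(LBINT x:{0<..}. q x * sfl_weight \<theta> \<beta> \<gamma> x) =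
      (\<Sum>i=0..M. q (sfl_node \<theta> \<beta> \<gamma> M i) * laguerre_weight \<theta> M i)" .
qed

theorem lemma2p1:
  fixes \<theta> \<beta> \<gamma> :: real
  assumes "\<theta> > -1" and "\<beta> > -1" and "0 < \<gamma>" and "\<gamma> < 1"
  shows
    "((\<forall>x>0. sfl 0 \<theta> \<beta> \<gamma> x = 1 \<and> sfl 1 \<theta> \<beta> \<gamma> x = - (\<beta> + 1) * x powr \<gamma> + \<theta> + 1) \<and>
      (\<forall>m\<ge>1. \<forall>x>0. sfl (m + 1) \<theta> \<beta> \<gamma> x =
         (2 * real m + \<theta> + 1 - (\<beta> + 1) * x powr \<gamma>) / (real m + 1) * sfl m \<theta> \<beta> \<gamma> x
         - (real m + \<theta>) / (real m + 1) * sfl (m - 1) \<theta> \<beta> \<gamma> x))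
     \<and>
     (\<forall>m\<ge>1. \<forall>x>0.
        sfl m \<theta> \<beta> \<gamma> differentiable (at x) \<and>
        - mapped_deriv \<beta> \<gamma> (sfl m \<theta> \<beta> \<gamma>) x = sfl (m - 1) (\<theta> + 1) \<beta> \<gamma> x \<and>
        sfl (m - 1) (\<theta> + 1) \<beta> \<gamma> x = (\<Sum>r=0..m-1. sfl r \<theta> \<beta> \<gamma> x))
     \<and>
     (\<forall>m l.
        set_integrable lborel {0<..}
          (\<lambda>x. sfl m \<theta> \<beta> \<gamma> x * sfl l \<theta> \<beta> \<gamma> x * sfl_weight \<theta> \<beta> \<gamma> x) \<and>
        (LBINT x:{0<..}. sfl m \<theta> \<beta> \<gamma> x * sfl l \<theta> \<beta> \<gamma> x * sfl_weight \<theta> \<beta> \<gamma> x)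
          = (if m = l then laguerre_norm m \<theta> else 0))
     \<and>
     (\<forall>m. \<forall>x>0.
        sfl m \<theta> \<beta> \<gamma> differentiable (at x) \<and>
        sfl_flux m \<theta> \<beta> \<gamma> differentiable (at x) \<and>
        inverse (sfl_weight \<theta> \<beta> \<gamma> x) * deriv (sfl_flux m \<theta> \<beta> \<gamma>) x
          + real m * \<gamma> * sfl m \<theta> \<beta> \<gamma> x = 0)
     \<and>
     (\<forall>M. \<forall>q \<in> frac_poly_space \<gamma> (2 * M + 1).
        set_integrable lborel {0<..} (\<lambda>x. q x * sfl_weight \<theta> \<beta> \<gamma> x) \<and>
        (LBINT x:{0<..}. q x * sfl_weight \<theta> \<beta> \<gamma> x)
          = (\<Sum>i=0..M. q (sfl_node \<theta> \<beta> \<gamma> M i) * laguerre_weight \<theta> M i))"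
proof (intro conjI allI ballI impI)
  fix x :: real and m :: nat assume x: "x > 0"
  show "sfl 0 \<theta> \<beta> \<gamma> x = 1" by (simp add: sfl_eq_poly)
  show "sfl 1 \<theta> \<beta> \<gamma> x = - (\<beta> + 1) * x powr \<gamma> + \<theta> + 1"
    by (simp add: sfl_def laguerre_def algebra_simps)
  \<comment> \<open>Stated twice because both the mapped-derivative and the Sturm-Liouville clause
    ask for it.\<close>
  show "sfl m \<theta> \<beta> \<gamma> differentiable (at x)" "sfl m \<theta> \<beta> \<gamma> differentiable (at x)"
    using sfl_has_real_derivative[OF x] real_differentiable_def by blast+
  show "sfl_flux m \<theta> \<beta> \<gamma> differentiable (at x)"
    and "inverse (sfl_weight \<theta> \<beta> \<gamma> x) * deriv (sfl_flux m \<theta> \<beta> \<gamma>) x + real m * \<gamma> * sfl m \<theta> \<beta> \<gamma> x = 0"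
  proof -
    have "(sfl_flux m \<theta> \<beta> \<gamma> has_real_derivative
        - \<gamma> * real m * sfl m \<theta> \<beta> \<gamma> x * sfl_weight \<theta> \<beta> \<gamma> x) (at x)"
    proof (cases m)
      case 0
      \<comment> \<open>For \<open>m = 0\<close> the function is constant, so the flux vanishes
        identically, as does the factor \<open>real m\<close>.\<close>
      have "sfl 0 \<theta> \<beta> \<gamma> = (\<lambda>x. 1)" by (simp add: sfl_eq_poly fun_eq_iff)
      then have "sfl_flux 0 \<theta> \<beta> \<gamma> = (\<lambda>x. 0)" by (simp add: sfl_flux_def[abs_def])
      then show ?thesis using 0 by simp
    next
      case (Suc n)
      then show ?thesis
        using sfl_flux_Suc_has_real_derivative[OF assms(2) x, of n \<theta> \<gamma>] by (simp add: add_ac)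
    qed
    then show "sfl_flux m \<theta> \<beta> \<gamma> differentiable (at x)"
      and "inverse (sfl_weight \<theta> \<beta> \<gamma> x) * deriv (sfl_flux m \<theta> \<beta> \<gamma>) x + real m * \<gamma> * sfl m \<theta> \<beta> \<gamma> x = 0"
      using sfl_weight_pos[OF assms(2,3) x, of \<theta>]
      by (auto simp: real_differentiable_def DERIV_imp_deriv)
  qed
  assume "m \<ge> 1"
  then obtain n where m: "m = Suc n" by (cases m) auto
  show "sfl (m + 1) \<theta> \<beta> \<gamma> x =
         (2 * real m + \<theta> + 1 - (\<beta> + 1) * x powr \<gamma>) / (real m + 1) * sfl m \<theta> \<beta> \<gamma> x
         - (real m + \<theta>) / (real m + 1) * sfl (m - 1) \<theta> \<beta> \<gamma> x"
    using sfl_recurrence[of n \<theta> \<beta> \<gamma> x] m by simp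
  show "- mapped_deriv \<beta> \<gamma> (sfl m \<theta> \<beta> \<gamma>) x = sfl (m - 1) (\<theta> + 1) \<beta> \<gamma> x"
    using mapped_deriv_sfl_Suc[OF assms(2,3) x] m by simp
  show "sfl (m - 1) (\<theta> + 1) \<beta> \<gamma> x = (\<Sum>r=0..m-1. sfl r \<theta> \<beta> \<gamma> x)"
    unfolding sfl_eq_poly by (rule laguerre_poly_sum)
next
  fix m l
  note sub = laguerre_functional_substitution[OF assms(1-3), of "laguerre_poly m \<theta> * laguerre_poly l \<theta>"]
  show "set_integrable lborel {0<..}
      (\<lambda>x. sfl m \<theta> \<beta> \<gamma> x * sfl l \<theta> \<beta> \<gamma> x * sfl_weight \<theta> \<beta> \<gamma> x)"
    using sub(1) by (simp add: sfl_eq_poly)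
  show "(LBINT x:{0<..}. sfl m \<theta> \<beta> \<gamma> x * sfl l \<theta> \<beta> \<gamma> x * sfl_weight \<theta> \<beta> \<gamma> x)
      = (if m = l then laguerre_norm m \<theta> else 0)"
    using sub(2) laguerre_functional_orthogonal[OF assms(1)] by (simp add: sfl_eq_poly)
next
  fix M q assume "q \<in> frac_poly_space \<gamma> (2 * M + 1)"
  note sfl_quadrature[OF assms(1-3) this]
  then show "set_integrable lborel {0<..} (\<lambda>x. q x * sfl_weight \<theta> \<beta> \<gamma> x)"
    and "(LBINT x:{0<..}. q x * sfl_weight \<theta> \<beta> \<gamma> x)
      = (\<Sum>i=0..M. q (sfl_node \<theta> \<beta> \<gamma> M i) * laguerre_weight \<theta> M i)"
    by blast+
qed

end
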